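(* Let $M\ge 1$, let $\mu_1,\dots,\mu_M\in\mathbb{R}$, $\sigma_1,\dots,\sigma_M>0$, $P_i=\mathcal N(\mu_i,\sigma_i^2)$, $P_{\mathrm{ens}}=\frac1M\sum_{i=1}^M P_i$ and $P_*=\mathcal N(\mu_*,\sigma_*^2)$, where $\mu_*=\frac1M\sum_{i=1}^M\mu_i$ and $\sigma_*^2=\frac1M\sum_{i=1}^M(\sigma_i^2+\mu_i^2)-\mu_*^2$. Let $S$, $H$ and $d$ be the expected score, entropy and divergence functions of the quadratic score, and write $\mathcal N(a\mid b,s^2)=\frac1{\sqrt{2\pi s^2}}\exp\!\big(-\frac{(a-b)^2}{2s^2}\big)$. Then the following hold. Bayes risks: $$\frac1M\sum_{i=1}^M H(P_i)=-\frac1{2M\sqrt\pi}\sum_{i=1}^M\frac1{\sigma_i},\qquad H(P_* )=-\frac1{2\sqrt{\pi\sigma_*^2}},$$ $$H(P_{\mathrm{ens}})=-\frac1{M^2}\sum_{i=1}^M\sum_{j=1}^M\mathcal N(\mu_i\mid\mu_j,\sigma_i^2+\sigma_j^2)=\frac1{2M}\sum_{i=1}^M H(P_i)+\frac1{2M^2}\sum_{i=1}^M\sum_{j=1}^M S(P_i,P_j).$$ Excess risks: $$\frac1{M^2}\sum_{i=1}^M\sum_{j=1}^M d(P_i,P_j)=\frac1{M\sqrt\pi}\sum_{i=1}^M\frac1{\sigma_i}-\frac2{M^2}\sum_{i=1}^M\sum_{j=1}^M\mathcal N(\mu_i\mid\mu_j,\sigma_i^2+\sigma_j^2),$$ $$\frac1M\sum_{i=1}^M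 d(P_{\mathrm{ens}},P_i)=\frac1M\sum_{i=1}^M d(P_i,P_{\mathrm{ens}})=\frac1{2M\sqrt\pi}\sum_{i=1}^M\frac1{\sigma_i}-\frac2{M^2}\sum_{i=1}^M\sum_{j=1}^M\mathcal N(\mu_i\mid\mu_j,\sigma_i^2+\sigma_j^2)-H(P_{\mathrm{ens}})=\frac12\cdot\frac1{M^2}\sum_{i=1}^M\sum_{j=1}^M d(P_i,P_j),$$ $$\frac1M\sum_{i=1}^M d(P_*,P_i)=\frac1M\sum_{i=1}^M d(P_i,P_* )=\frac1{2M\sqrt\pi}\sum_{i=1}^M\frac1{\sigma_i}-\frac2M\sum_{i=1}^M\mathcal N(\mu_*\mid\mu_i,\sigma_*^2+\sigma_i^2)+\frac1{2\sqrt{\pi\sigma_*^2}},$$ $$d(P_*,P_{\mathrm{ens}})=d(P_{\mathrm{ens}},P_* )=-\frac2M\sum_{j=1}^M\mathcal N(\mu_*\mid\mu_j,\sigma_*^2+\sigma_j^2)-H(P_* )-H(P_{\mathrm{ens}}).$$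
   Context: For a probability measure $P$ on $\mathbb{R}$ with square-integrable Lebesgue density $p$ and $y\in\mathbb{R}$, the quadratic score is $\mathrm{QS}(P,y)=-2p(y)+\int_{\mathbb{R}}p(t)^2\,dt$. For probability measures $P,Q$ the expected score is $S(P,Q)=\int \mathrm{QS}(P,y)\,dQ(y)$. The entropy function is $H(P)=S(P,P)$ and the divergence function is $d(P,Q)=S(P,Q)-H(Q)$ (first argument: prediction; second argument: true distribution). $\mathcal N(\mu,\sigma^2)$ is the Gaussian with mean $\mu$ and variance $\sigma^2$; $P_{\mathrm{ens}}$ is the equally weighted Gaussian mixture, whose mean and variance are $\mu_*$ and $\sigma_*^2$. *)

theory Defs
  imports "HOL-Probability.Probability"
begin

definition lebesgue_pdf :: "real measure \<Rightarrow> real \<Rightarrow> real" where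
  "lebesgue_pdf P y = enn2real (RN_deriv lborel P y)"

(* Meaningful for measures with a square-integrable Lebesgue density. The density is
   determined only up to a null set, and so is the score as a function of y; the expected
   score under an absolutely continuous measure does not depend on the version, see
   expected_quadratic_score_density. *)
definition quadratic_score :: "real measure \<Rightarrow> real \<Rightarrow> real" where
  "quadratic_score P y = - 2 * lebesgue_pdf P y + (LINT t|lborel. (lebesgue_pdf P t)\<^sup>2)"

definition expected_score ::
    "(real measure \<Rightarrow> real \<Rightarrow> real) \<Rightarrow> real measure \<Rightarrow> real measure \<Rightarrow> real" where
  "expected_score sc P Q = (LINT y|Q. sc P y)"

definition score_entropy :: "(real measure \<Rightarrow> real \<Rightarrow> real) \<Rightarrow> real measure \<Rightarrow> real" where
  "score_entropy sc P = expected_score sc P P"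

(* First argument: prediction; second argument: true distribution. *)
definition score_divergence ::
    "(real measure \<Rightarrow> real \<Rightarrow> real) \<Rightarrow> real measure \<Rightarrow> real measure \<Rightarrow> real" where
  "score_divergence sc P Q = expected_score sc P Q - score_entropy sc Q"

(* The last argument is the variance, whereas normal_density takes the standard deviation. *)
definition gauss_pdf :: "real \<Rightarrow> real \<Rightarrow> real \<Rightarrow> real" where
  "gauss_pdf a b v = 1 / sqrt (2 * pi * v) * exp (- ((a - b)\<^sup>2 / (2 * v)))"

definition gauss_measure :: "real \<Rightarrow> real \<Rightarrow> real measure" where
  "gauss_measure m v = density lborel (\<lambda>x. ennreal (gauss_pdf x m v))"

definition equal_mixture :: "nat \<Rightarrow> (nat \<Rightarrow> real measure) \<Rightarrow> real measure" where
  "equal_mixture M P =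
     measure_of UNIV (sets borel) (\<lambda>A. ennreal (1 / real M) * (\<Sum>i=1..M. emeasure (P i) A))"

lemma gauss_pdf_eq_normal_density:
  "v \<ge> 0 \<Longrightarrow> gauss_pdf a b v = normal_density b (sqrt v) a"
  by (simp add: gauss_pdf_def normal_density_def)

lemma prob_space_gauss_measure:
  assumes "v > 0"
  shows "prob_space (gauss_measure m v)"
  using prob_space_normal_density[of "sqrt v" m] assms
  by (simp add: gauss_measure_def gauss_pdf_eq_normal_density)

lemma emeasure_equal_mixture:
  assumes "\<And>i. i \<in> {1..M} \<Longrightarrow> sets (P i) = sets borel" and "A \<in> sets borel"
  shows "emeasure (equal_mixture M P) A
    = ennreal (1 / real M) * (\<Sum>i=1..M. emeasure (P i) A)"
proof (rule emeasure_measure_of[OF equal_mixture_def])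
  show "sets borel \<subseteq> Pow (UNIV :: real set)" by simp
  have s: "sets (equal_mixture M P) = sets borel"
    unfolding equal_mixture_def
    using sets.sigma_sets_eq[of "borel :: real measure"] by (simp add: sets_measure_of)
  show "A \<in> sets (equal_mixture M P)" using s assms(2) by simp
  show "positive (sets (equal_mixture M P))
      (\<lambda>A. ennreal (1 / real M) * (\<Sum>i=1..M. emeasure (P i) A))"
    by (simp add: positive_def)
  show "countably_additive (sets (equal_mixture M P))
      (\<lambda>A. ennreal (1 / real M) * (\<Sum>i=1..M. emeasure (P i) A))"
    unfolding s
  proof (rule countably_additiveI)
    fix B :: "nat \<Rightarrow> real set"
    assume B: "range B \<subseteq> sets borel" "disjoint_family B"
    have "(\<Sum>n. \<Sum>i=1..M. emeasure (P i) (B n)) = (\<Sum>i=1..M. \<Sum>n. emeasure (P i) (B n))"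
      by (rule suminf_sum) auto
    also have "\<dots> = (\<Sum>i=1..M. emeasure (P i) (\<Union>(range B)))"
      using B assms(1) by (intro sum.cong refl suminf_emeasure) auto
    finally show "(\<Sum>n. ennreal (1 / real M) * (\<Sum>i=1..M. emeasure (P i) (B n)))
        = ennreal (1 / real M) * (\<Sum>i=1..M. emeasure (P i) (\<Union>(range B)))"
      by simp
  qed
qed

lemma AE_lebesgue_pdf_density:
  assumes "p \<in> borel_measurable borel" and "\<And>x. p x \<ge> 0"
  shows "AE x in lborel. lebesgue_pdf (density lborel (\<lambda>x. ennreal (p x))) x = p x"
proof -
  have "AE x in lborel. ennreal (p x) = RN_deriv lborel (density lborel (\<lambda>x. ennreal (p x))) x"
    using assms(1) by (intro sigma_finite_measure.RN_deriv_unique sigma_finite_lborel) auto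
  then show ?thesis
    by eventually_elim (metis assms(2) enn2real_ennreal lebesgue_pdf_def)
qed

lemma expected_quadratic_score_density:
  assumes p: "p \<in> borel_measurable borel" "\<And>x. p x \<ge> 0"
    and q: "q \<in> borel_measurable borel" "\<And>x. q x \<ge> 0"
  shows "expected_score quadratic_score
      (density lborel (\<lambda>x. ennreal (p x))) (density lborel (\<lambda>x. ennreal (q x)))
    = (LINT y|lborel. q y * (- 2 * p y + (LINT t|lborel. (p t)\<^sup>2)))"
proof -
  let ?P = "density lborel (\<lambda>x. ennreal (p x))"
  have [measurable]: "lebesgue_pdf ?P \<in> borel_measurable borel"
    unfolding lebesgue_pdf_def by measurable
  note [measurable] = p(1) q(1)
  have ae: "AE x in lborel. lebesgue_pdf ?P x = p x"
    using p by (rule AE_lebesgue_pdf_density)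
  have I: "(LINT t|lborel. (lebesgue_pdf ?P t)\<^sup>2) = (LINT t|lborel. (p t)\<^sup>2)"
    using ae by (intro integral_cong_AE) auto
  have "(LINT y|density lborel (\<lambda>x. ennreal (q x)). quadratic_score ?P y)
      = (LINT y|lborel. q y *\<^sub>R quadratic_score ?P y)"
    using q(2) by (intro integral_density) (auto simp: quadratic_score_def)
  also have "\<dots> = (LINT y|lborel. q y * (- 2 * p y + (LINT t|lborel. (p t)\<^sup>2)))"
    using ae by (intro integral_cong_AE) (auto simp: quadratic_score_def I)
  finally show ?thesis by (simp add: expected_score_def)
qed

end

theory Submission
  imports Defs
begin

text \<open>
  For densities \<open>p\<close> and \<open>q\<close> the expected quadratic score is
  \<open>S(P,Q) = \<langle>p,p\<rangle> - 2 \<langle>p,q\<rangle>\<close> with the inner product of \<open>L\<^sup>2\<close>, so \<open>H(P) = - \<langle>p,p\<rangle>\<close> and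
  \<open>d(P,Q) = \<parallel>p - q\<parallel>\<^sup>2\<close> is symmetric. The inner product of two Gaussian densities is a value of
  their convolution, again a Gaussian density, with the variances added; the mixture follows by
  bilinearity.
\<close>

section \<open>Gaussian densities and the integrals of their products\<close>

lemma gauss_pdf_nonneg: "v \<ge> 0 \<Longrightarrow> 0 \<le> gauss_pdf a b v"
  by (simp add: gauss_pdf_eq_normal_density)

lemma gauss_pdf_self: "gauss_pdf a a (v + v) = 1 / (2 * sqrt (pi * v))"
proof -
  have "sqrt (2 * pi * (v + v)) = sqrt (2\<^sup>2 * (pi * v))"
    by (simp add: algebra_simps)
  also have "\<dots> = 2 * sqrt (pi * v)"
    unfolding real_sqrt_mult by simp
  finally show ?thesis
    by (simp add: gauss_pdf_def)
qed

lemma borel_measurable_gauss_pdf [measurable]: "(\<lambda>x. gauss_pdf x m v) \<in> borel_measurable borel"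
  unfolding gauss_pdf_def by measurable

lemma has_bochner_integral_gauss_pdf:
  assumes "v > 0"
  shows "has_bochner_integral lborel (\<lambda>x. gauss_pdf x m v) 1"
  using assms integrable_normal_density[of "sqrt v" m] integral_normal_density[of "sqrt v" m]
  by (simp add: gauss_pdf_eq_normal_density has_bochner_integral_iff)

text \<open>Since (x - a)^2 = (a - x)^2, the first factor is the centred density of variance
  \<open>v\<close> at a - x. Shifting the variable by \<open>b\<close> then turns the integral into
  the convolution of two centred Gaussian densities at a - b, where variances add. Computing it as a
  nonnegative integral gives integrability along with the value.\<close>

lemma has_bochner_integral_gauss_pdf_mult:
  assumes v: "v > 0" and w: "w > 0"
  shows "has_bochner_integral lborel (\<lambda>x. gauss_pdf x a v * gauss_pdf x b w) (gauss_pdf a b (v + w))"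
proof (rule has_bochner_integral_nn_integral)
  define f where
    "f y = ennreal (normal_density 0 (sqrt v) (a - b - y) * normal_density 0 (sqrt w) y)" for y
  have [measurable]: "f \<in> borel_measurable borel"
    unfolding f_def by measurable
  \<comment> \<open>At y - b the argument a - b - (y - b) of the first factor is a - y. The factor 1
    presents the shift as an affine map of slope 1 for the change of variables.\<close>
  have "ennreal (gauss_pdf y a v * gauss_pdf y b w) = f (- b + 1 * y)" for y
    using v w by (simp add: f_def gauss_pdf_eq_normal_density normal_density_def power2_commute)
  then have "(\<integral>\<^sup>+y. ennreal (gauss_pdf y a v * gauss_pdf y b w) \<partial>lborel)
      = (\<integral>\<^sup>+y. f (- b + 1 * y) \<partial>lborel)"
    by simp
  also have "\<dots> = (\<integral>\<^sup>+y. f y \<partial>lborel)"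
    using nn_integral_real_affine[of f 1 "- b"] by simp
  also have "\<dots> = ennreal (normal_density 0 (sqrt (v + w)) (a - b))"
    using fun_cong[OF conv_normal_density_zero_mean[of "sqrt v" "sqrt w"], of "a - b"] v w
    by (simp add: f_def)
  also have "\<dots> = ennreal (gauss_pdf a b (v + w))"
    using v w by (simp add: gauss_pdf_def normal_density_def)
  finally show "(\<integral>\<^sup>+y. ennreal (gauss_pdf y a v * gauss_pdf y b w) \<partial>lborel)
      = ennreal (gauss_pdf a b (v + w))" .
qed (use v w in \<open>auto simp: gauss_pdf_nonneg\<close>)

text \<open>The mixture is given as a set function, while scores are computed from densities. On
  each Borel set the weight and the finite sum move inside the nonnegative integral.\<close>

lemma equal_mixture_density:
  assumes [measurable]: "\<And>i. i \<in> {1..M} \<Longrightarrow> p i \<in> borel_measurable borel"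
    and nonneg: "\<And>i x. i \<in> {1..M} \<Longrightarrow> 0 \<le> p i x"
  shows "equal_mixture M (\<lambda>i. density lborel (\<lambda>x. ennreal (p i x)))
    = density lborel (\<lambda>x. ennreal (1 / real M * (\<Sum>i=1..M. p i x)))"
proof (rule measure_eqI)
  show "sets (equal_mixture M (\<lambda>i. density lborel (\<lambda>x. ennreal (p i x))))
      = sets (density lborel (\<lambda>x. ennreal (1 / real M * (\<Sum>i=1..M. p i x))))"
    unfolding equal_mixture_def
    using sets.sigma_sets_eq[of "borel :: real measure"] by (simp add: sets_measure_of)
  then have s: "sets (equal_mixture M (\<lambda>i. density lborel (\<lambda>x. ennreal (p i x)))) = sets borel"
    by simp
  fix A assume "A \<in> sets (equal_mixture M (\<lambda>i. density lborel (\<lambda>x. ennreal (p i x))))"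
  with s have A [measurable]: "A \<in> sets borel"
    by simp
  have "emeasure (equal_mixture M (\<lambda>i. density lborel (\<lambda>x. ennreal (p i x)))) A
      = ennreal (1 / real M) * (\<Sum>i=1..M. \<integral>\<^sup>+x. ennreal (p i x) * indicator A x \<partial>lborel)"
    by (simp add: emeasure_equal_mixture emeasure_density)
  also have "\<dots> = (\<integral>\<^sup>+x. ennreal (1 / real M) * (\<Sum>i=1..M. ennreal (p i x) * indicator A x) \<partial>lborel)"
    by (subst nn_integral_cmult, measurable, subst nn_integral_sum) simp_all
  also have "\<dots> = (\<integral>\<^sup>+x. ennreal (1 / real M * (\<Sum>i=1..M. p i x)) * indicator A x \<partial>lborel)"
  proof (rule nn_integral_cong)
    fix x
    \<comment> \<open>Nonnegativity matters here: \<open>ennreal\<close> sends negative reals to 0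
      and respects sums and products only of nonnegative terms.\<close>
    have "ennreal (1 / real M * (\<Sum>i=1..M. p i x)) = ennreal (1 / real M) * (\<Sum>i=1..M. ennreal (p i x))"
      using sum_nonneg[of "{1..M}" "\<lambda>i. p i x"] sum_ennreal[of "{1..M}" "\<lambda>i. p i x"] nonneg[of _ x]
      by (simp del: One_nat_def flip: ennreal_mult)
    then show "ennreal (1 / real M) * (\<Sum>i=1..M. ennreal (p i x) * indicator A x)
        = ennreal (1 / real M * (\<Sum>i=1..M. p i x)) * indicator A x"
      by (simp only: sum_distrib_right mult.assoc)
  qed
  also have "\<dots> = emeasure (density lborel (\<lambda>x. ennreal (1 / real M * (\<Sum>i=1..M. p i x)))) A"
    by (simp add: emeasure_density)
  finally show "emeasure (equal_mixture M (\<lambda>i. density lborel (\<lambda>x. ennreal (p i x)))) A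
      = emeasure (density lborel (\<lambda>x. ennreal (1 / real M * (\<Sum>i=1..M. p i x)))) A" .
qed

text \<open>The integrand is a * q - 2 * p * q with the constant a = \<langle>p,p\<rangle>, and q
  has integral 1. The inner products enter through \<open>has_bochner_integral\<close> because
  linearity needs integrability, not only values: a non-integrable function gets integral 0 by
  default.\<close>

lemma expected_quadratic_score_eq:
  assumes p: "p \<in> borel_measurable borel" "\<And>x. p x \<ge> 0"
    and q: "q \<in> borel_measurable borel" "\<And>x. q x \<ge> 0"
    and q1: "has_bochner_integral lborel q 1"
    and pp: "has_bochner_integral lborel (\<lambda>x. p x * p x) a"
    and pq: "has_bochner_integral lborel (\<lambda>x. p x * q x) b"
  shows "expected_score quadratic_score
      (density lborel (\<lambda>x. ennreal (p x))) (density lborel (\<lambda>x. ennreal (q x))) = a - 2 * b"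
proof -
  have "has_bochner_integral lborel (\<lambda>y. a * q y - 2 * (p y * q y)) (a * 1 - 2 * b)"
    by (intro has_bochner_integral_diff has_bochner_integral_mult_right q1 pq)
  moreover have "(LINT t|lborel. (p t)\<^sup>2) = a"
    using has_bochner_integral_integral_eq[OF pp] by (simp add: power2_eq_square)
  ultimately show ?thesis
    by (subst expected_quadratic_score_density[OF p q])
       (auto dest!: has_bochner_integral_integral_eq simp: algebra_simps)
qed

text \<open>Applied to the component means, this shows that their spread contributes a nonnegative
  amount to the mixture variance.\<close>

lemma sum_squared_deviation_mean:
  fixes x :: "'a \<Rightarrow> real"
  assumes "finite A" "A \<noteq> {}"
  defines "m \<equiv> (\<Sum>i\<in>A. x i) / real (card A)"
  shows "(\<Sum>i\<in>A. (x i - m)\<^sup>2) = (\<Sum>i\<in>A. (x i)\<^sup>2) - real (card A) * m\<^sup>2"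
proof -
  have "(\<Sum>i\<in>A. (x i - m)\<^sup>2) = (\<Sum>i\<in>A. (x i)\<^sup>2 + m\<^sup>2 - 2 * m * x i)"
    by (simp add: power2_diff mult_ac)
  also have "\<dots> = (\<Sum>i\<in>A. (x i)\<^sup>2) + real (card A) * m\<^sup>2 - 2 * m * (\<Sum>i\<in>A. x i)"
    by (simp add: sum.distrib sum_subtractf sum_distrib_left)
  also have "(\<Sum>i\<in>A. x i) = real (card A) * m"
    using assms(1,2) by (simp add: m_def)
  finally show ?thesis
    by (simp add: power2_eq_square)
qed

theorem mainTheorem3:
  fixes M :: nat
    and \<mu> \<sigma> :: "nat \<Rightarrow> real"
    and \<mu>s vs :: real
    and P :: "nat \<Rightarrow> real measure"
    and Pens Ps :: "real measure"
    and S d :: "real measure \<Rightarrow> real measure \<Rightarrow> real"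
    and H :: "real measure \<Rightarrow> real"
  assumes "M \<ge> 1"
    and "\<And>i. i \<in> {1..M} \<Longrightarrow> \<sigma> i > 0"
    and "P = (\<lambda>i. gauss_measure (\<mu> i) ((\<sigma> i)\<^sup>2))"
    and "Pens = equal_mixture M P"
    and "\<mu>s = 1 / real M * (\<Sum>i=1..M. \<mu> i)"
    and "vs = 1 / real M * (\<Sum>i=1..M. (\<sigma> i)\<^sup>2 + (\<mu> i)\<^sup>2) - \<mu>s\<^sup>2"
    and "Ps = gauss_measure \<mu>s vs"
    and "S = expected_score quadratic_score"
    and "H = score_entropy quadratic_score"
    and "d = score_divergence quadratic_score"
  shows
    "(1 / real M * (\<Sum>i=1..M. H (P i))
       = - (1 / (2 * real M * sqrt pi)) * (\<Sum>i=1..M. 1 / \<sigma> i)) \<and>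
     (H Ps = - (1 / (2 * sqrt (pi * vs)))) \<and>
     (H Pens = - (1 / (real M)\<^sup>2)
       * (\<Sum>i=1..M. \<Sum>j=1..M. gauss_pdf (\<mu> i) (\<mu> j) ((\<sigma> i)\<^sup>2 + (\<sigma> j)\<^sup>2))) \<and>
     (H Pens = 1 / (2 * real M) * (\<Sum>i=1..M. H (P i))
       + 1 / (2 * (real M)\<^sup>2) * (\<Sum>i=1..M. \<Sum>j=1..M. S (P i) (P j))) \<and>
     (1 / (real M)\<^sup>2 * (\<Sum>i=1..M. \<Sum>j=1..M. d (P i) (P j))
       = 1 / (real M * sqrt pi) * (\<Sum>i=1..M. 1 / \<sigma> i)
         - 2 / (real M)\<^sup>2
           * (\<Sum>i=1..M. \<Sum>j=1..M. gauss_pdf (\<mu> i) (\<mu> j) ((\<sigma> i)\<^sup>2 + (\<sigma> j)\<^sup>2))) \<and>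
     (1 / real M * (\<Sum>i=1..M. d Pens (P i)) = 1 / real M * (\<Sum>i=1..M. d (P i) Pens)) \<and>
     (1 / real M * (\<Sum>i=1..M. d (P i) Pens)
       = 1 / (2 * real M * sqrt pi) * (\<Sum>i=1..M. 1 / \<sigma> i)
         - 2 / (real M)\<^sup>2
           * (\<Sum>i=1..M. \<Sum>j=1..M. gauss_pdf (\<mu> i) (\<mu> j) ((\<sigma> i)\<^sup>2 + (\<sigma> j)\<^sup>2))
         - H Pens) \<and>
     (1 / real M * (\<Sum>i=1..M. d (P i) Pens)
       = 1 / 2 * (1 / (real M)\<^sup>2 * (\<Sum>i=1..M. \<Sum>j=1..M. d (P i) (P j)))) \<and>
     (1 / real M * (\<Sum>i=1..M. d Ps (P i)) = 1 / real M * (\<Sum>i=1..M. d (P i) Ps)) \<and>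
     (1 / real M * (\<Sum>i=1..M. d (P i) Ps)
       = 1 / (2 * real M * sqrt pi) * (\<Sum>i=1..M. 1 / \<sigma> i)
         - 2 / real M * (\<Sum>i=1..M. gauss_pdf \<mu>s (\<mu> i) (vs + (\<sigma> i)\<^sup>2))
         + 1 / (2 * sqrt (pi * vs))) \<and>
     (d Ps Pens = d Pens Ps) \<and>
     (d Pens Ps = - (2 / real M) * (\<Sum>j=1..M. gauss_pdf \<mu>s (\<mu> j) (vs + (\<sigma> j)\<^sup>2))
         - H Ps - H Pens)"
proof -
  note M = assms(1) and \<sigma> = assms(2)
  \<comment> \<open>Law of total variance: \<open>real M * vs\<close> is the sum of the component
    variances, which is positive, plus the sum of squared deviations of the means from
    \<open>\<mu>s\<close>.\<close>
  have vs: "vs > 0"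
  proof -
    have "(\<Sum>i=1..M. (\<mu> i)\<^sup>2) - real M * \<mu>s\<^sup>2 \<ge> 0"
      using sum_squared_deviation_mean[of "{1..M}" \<mu>] M sum_nonneg[of "{1..M}" "\<lambda>i. (\<mu> i - \<mu>s)\<^sup>2"]
      by (simp add: assms(5))
    moreover have "(\<Sum>i=1..M. (\<sigma> i)\<^sup>2) > 0"
      using M \<sigma> by (intro sum_pos) fastforce+
    ultimately have "real M * vs > 0"
      using M by (simp add: assms(6) sum.distrib algebra_simps)
    then show ?thesis
      using M by (simp add: zero_less_mult_iff)
  qed
  \<comment> \<open>\<open>g i\<close>, \<open>f\<close> and \<open>h\<close> are the densities of
    \<open>P i\<close>, \<open>Pens\<close> and \<open>Ps\<close>. The inner products are G i j =
    \<langle>g i, g j\<rangle>, K i = \<langle>h, g i\<rangle>, R j = \<langle>f, g j\<rangle>, T =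
    \<langle>f, f\<rangle>, U = \<langle>h, f\<rangle> and V = \<langle>h, h\<rangle>. Every score
    below is linear in these numbers.\<close>
  define g where "g i x = gauss_pdf x (\<mu> i) ((\<sigma> i)\<^sup>2)" for i x
  define f where "f x = 1 / real M * (\<Sum>i=1..M. g i x)" for x
  define h where "h x = gauss_pdf x \<mu>s vs" for x
  define G where "G i j = gauss_pdf (\<mu> i) (\<mu> j) ((\<sigma> i)\<^sup>2 + (\<sigma> j)\<^sup>2)" for i j
  define K where "K i = gauss_pdf \<mu>s (\<mu> i) (vs + (\<sigma> i)\<^sup>2)" for i
  define R where "R j = 1 / real M * (\<Sum>i=1..M. G i j)" for j
  define T where "T = 1 / real M * (\<Sum>j=1..M. R j)"
  define U where "U = 1 / real M * (\<Sum>j=1..M. K j)"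
  define V where "V = 1 / (2 * sqrt (pi * vs))"
  define A where "A = (\<Sum>i=1..M. 1 / \<sigma> i)"
  have v: "(\<sigma> i)\<^sup>2 > 0" if "i \<in> {1..M}" for i
    using \<sigma>[OF that] by simp

  have meas [measurable]: "g i \<in> borel_measurable borel" "h \<in> borel_measurable borel"
      "f \<in> borel_measurable borel" for i
    unfolding f_def g_def h_def by measurable
  \<comment> \<open>This holds for every index, also outside the range where \<sigma> is known to be
    positive, since a square is a nonnegative variance.\<close>
  have g0: "0 \<le> g i x" for i x
    by (simp add: g_def gauss_pdf_nonneg)
  have f0: "0 \<le> f x" for x
    by (simp add: f_def g0 sum_nonneg)
  have h0: "0 \<le> h x" for x
    using vs by (simp add: h_def gauss_pdf_nonneg)

  \<comment> \<open>The measures in terms of their densities\<close>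
  have P: "P i = density lborel (\<lambda>x. ennreal (g i x))" for i
    by (simp add: assms(3) gauss_measure_def g_def)
  have Ps: "Ps = density lborel (\<lambda>x. ennreal (h x))"
    by (simp add: assms(7) gauss_measure_def h_def)
  have Pens: "Pens = density lborel (\<lambda>x. ennreal (f x))"
    using equal_mixture_density[of M g] by (simp add: assms(4) P[abs_def] f_def g0)

  \<comment> \<open>Total masses and inner products\<close>
  have g1: "has_bochner_integral lborel (g i) 1" if "i \<in> {1..M}" for i
    unfolding g_def using v[OF that] by (rule has_bochner_integral_gauss_pdf)
  have h1: "has_bochner_integral lborel h 1"
    unfolding h_def using vs by (rule has_bochner_integral_gauss_pdf)
  have f1: "has_bochner_integral lborel f 1"
  proof -
    have "has_bochner_integral lborel f (1 / real M * (\<Sum>i=1..M. 1))"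
      unfolding f_def by (intro has_bochner_integral_mult_right has_bochner_integral_sum g1)
    then show ?thesis
      using M by simp
  qed

  have gg: "has_bochner_integral lborel (\<lambda>x. g i x * g j x) (G i j)"
    if "i \<in> {1..M}" "j \<in> {1..M}" for i j
    unfolding g_def G_def using v[OF that(1)] v[OF that(2)]
    by (rule has_bochner_integral_gauss_pdf_mult)
  have hg: "has_bochner_integral lborel (\<lambda>x. h x * g i x) (K i)" if "i \<in> {1..M}" for i
    unfolding g_def h_def K_def using vs v[OF that]
    by (rule has_bochner_integral_gauss_pdf_mult)
  have hh: "has_bochner_integral lborel (\<lambda>x. h x * h x) V"
    using has_bochner_integral_gauss_pdf_mult[OF vs vs, of \<mu>s \<mu>s]
    unfolding h_def V_def gauss_pdf_self .
  have fg: "has_bochner_integral lborel (\<lambda>x. f x * g j x) (R j)" if "j \<in> {1..M}" for j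
    unfolding f_def R_def mult.assoc sum_distrib_right
    by (intro has_bochner_integral_mult_right has_bochner_integral_sum gg that)
  have hf: "has_bochner_integral lborel (\<lambda>x. h x * f x) U"
  proof -
    have "(\<lambda>x. h x * f x) = (\<lambda>x. 1 / real M * (\<Sum>i=1..M. h x * g i x))"
      by (simp add: f_def sum_distrib_left fun_eq_iff)
    then show ?thesis
      unfolding U_def by (simp only:) (intro has_bochner_integral_mult_right has_bochner_integral_sum hg)
  qed
  have ff: "has_bochner_integral lborel (\<lambda>x. f x * f x) T"
  proof -
    have "(\<lambda>x. f x * f x) = (\<lambda>x. 1 / real M * (\<Sum>i=1..M. f x * g i x))"
      \<comment> \<open>Only one factor is expanded, so each summand is an inner product of
        \<open>f\<close> with a component, which \<open>fg\<close> evaluates.\<close>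
      by (subst (2) f_def) (simp add: sum_distrib_left fun_eq_iff)
    then show ?thesis
      unfolding T_def by (simp only:) (intro has_bochner_integral_mult_right has_bochner_integral_sum fg)
  qed
  have gf: "has_bochner_integral lborel (\<lambda>x. g i x * f x) (R i)" if "i \<in> {1..M}" for i
    using fg[OF that] by (simp add: mult.commute)
  have gh: "has_bochner_integral lborel (\<lambda>x. g i x * h x) (K i)" if "i \<in> {1..M}" for i
    using hg[OF that] by (simp add: mult.commute)
  have fh: "has_bochner_integral lborel (\<lambda>x. f x * h x) U"
    using hf by (simp add: mult.commute)

  \<comment> \<open>Scores, entropies and divergences in terms of the inner products\<close>
  have S: "S (P i) (P j) = G i i - 2 * G i j" if "i \<in> {1..M}" "j \<in> {1..M}" for i j
    unfolding assms(8) P using that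
    by (intro expected_quadratic_score_eq meas g0 g1 gg)
  have H: "H Q = S Q Q" and d: "d Q Q' = S Q Q' - H Q'" for Q Q'
    by (simp_all add: assms(8-10) score_entropy_def score_divergence_def)
  have HP: "H (P i) = - G i i" if "i \<in> {1..M}" for i
    using that by (simp add: H S)
  have Hs: "H Ps = - V"
    unfolding H assms(8) Ps
    by (subst expected_quadratic_score_eq[OF meas(2) h0 meas(2) h0 h1 hh hh]) simp
  have He: "H Pens = - T"
    unfolding H assms(8) Pens
    by (subst expected_quadratic_score_eq[OF meas(3) f0 meas(3) f0 f1 ff ff]) simp
  have dPP: "d (P i) (P j) = G i i - 2 * G i j + G j j" if "i \<in> {1..M}" "j \<in> {1..M}" for i j
    using that by (simp add: d S HP)
  \<comment> \<open>This and \<open>dPe\<close> have the same right-hand side, the squared distance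
    of \<open>f\<close> and \<open>g i\<close>. The pairs \<open>dsP\<close>, \<open>dPs\<close> and
    \<open>dse\<close>, \<open>des\<close> agree in the same way, which gives all the claimed
    symmetries.\<close>
  have deP: "d Pens (P i) = T - 2 * R i + G i i" if "i \<in> {1..M}" for i
    unfolding d HP[OF that] unfolding assms(8) P Pens
    by (subst expected_quadratic_score_eq[OF meas(3) f0 meas(1) g0 g1[OF that] ff fg[OF that]]) simp
  have dPe: "d (P i) Pens = T - 2 * R i + G i i" if "i \<in> {1..M}" for i
    unfolding d He unfolding assms(8) P Pens
    by (subst expected_quadratic_score_eq[OF meas(1) g0 meas(3) f0 f1 gg[OF that that] gf[OF that]]) simp
  have dsP: "d Ps (P i) = V - 2 * K i + G i i" if "i \<in> {1..M}" for i
    unfolding d HP[OF that] unfolding assms(8) P Ps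
    by (subst expected_quadratic_score_eq[OF meas(2) h0 meas(1) g0 g1[OF that] hh hg[OF that]]) simp
  have dPs: "d (P i) Ps = V - 2 * K i + G i i" if "i \<in> {1..M}" for i
    unfolding d Hs unfolding assms(8) P Ps
    by (subst expected_quadratic_score_eq[OF meas(1) g0 meas(2) h0 h1 gg[OF that that] gh[OF that]]) simp
  have dse: "d Ps Pens = V - 2 * U + T"
    unfolding d He unfolding assms(8) Pens Ps
    by (subst expected_quadratic_score_eq[OF meas(2) h0 meas(3) f0 f1 hh hf]) simp
  have des: "d Pens Ps = V - 2 * U + T"
    unfolding d Hs unfolding assms(8) Pens Ps
    by (subst expected_quadratic_score_eq[OF meas(3) f0 meas(2) h0 h1 ff fh]) simp

  \<comment> \<open>Sums over the components\<close>
  have diag: "(\<Sum>i=1..M. G i i) = 1 / (2 * sqrt pi) * A"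
    unfolding A_def sum_distrib_left
  proof (rule sum.cong[OF refl])
    fix i assume "i \<in> {1..M}"
    then show "G i i = 1 / (2 * sqrt pi) * (1 / \<sigma> i)"
      using \<sigma>[of i] unfolding G_def gauss_pdf_self by (simp add: real_sqrt_mult)
  qed
  have RT: "(\<Sum>j=1..M. R j) = real M * T"
    using M by (simp add: T_def)
  have KU: "(\<Sum>j=1..M. K j) = real M * U"
    using M by (simp add: U_def)
  have GT: "(\<Sum>i=1..M. \<Sum>j=1..M. G i j) = (real M)\<^sup>2 * T"
  proof -
    \<comment> \<open>\<open>R j\<close> averages over the first index of \<open>G\<close>, so the
      order of summation is exchanged first.\<close>
    have "(\<Sum>i=1..M. \<Sum>j=1..M. G i j) = (\<Sum>j=1..M. real M * R j)"
      using M by (subst sum.swap) (simp add: R_def)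
    then show ?thesis
      using RT by (simp del: One_nat_def flip: sum_distrib_left add: power2_eq_square)
  qed
  have sum_HP: "(\<Sum>i=1..M. H (P i)) = - (1 / (2 * sqrt pi) * A)"
    by (simp add: HP sum_negf diag del: One_nat_def)
  have sum_S: "(\<Sum>i=1..M. \<Sum>j=1..M. S (P i) (P j))
      = real M * (1 / (2 * sqrt pi) * A) - 2 * ((real M)\<^sup>2 * T)"
  proof -
    have "(\<Sum>i=1..M. \<Sum>j=1..M. S (P i) (P j)) = (\<Sum>i=1..M. \<Sum>j=1..M. G i i - 2 * G i j)"
      by (intro sum.cong refl S)
    then show ?thesis
      by (simp add: sum_subtractf GT diag del: One_nat_def flip: sum_distrib_left)
  qed
  have sum_dPP: "(\<Sum>i=1..M. \<Sum>j=1..M. d (P i) (P j))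
      = real M * (1 / sqrt pi * A) - 2 * ((real M)\<^sup>2 * T)"
  proof -
    have "(\<Sum>i=1..M. \<Sum>j=1..M. d (P i) (P j)) = (\<Sum>i=1..M. \<Sum>j=1..M. G i i - 2 * G i j + G j j)"
      by (intro sum.cong refl dPP)
    also have "\<dots> = 2 * (real M * (\<Sum>i=1..M. G i i)) - 2 * (\<Sum>i=1..M. \<Sum>j=1..M. G i j)"
      by (simp add: sum_subtractf sum.distrib del: One_nat_def flip: sum_distrib_left)
    finally show ?thesis
      by (simp add: GT diag del: One_nat_def)
  qed
  \<comment> \<open>The average of \<open>R\<close> is \<open>T\<close>, so T - 2 * R averages to -
    T. Hence the mean divergence from the ensemble is the mean of \<open>G i i\<close> minus
    \<open>T\<close>, half of the mean pairwise divergence obtained from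
    \<open>sum_dPP\<close>.\<close>
  have sum_dPe: "(\<Sum>i=1..M. d (P i) Pens) = 1 / (2 * sqrt pi) * A - real M * T"
  proof -
    have "(\<Sum>i=1..M. d (P i) Pens) = (\<Sum>i=1..M. T - 2 * R i + G i i)"
      by (intro sum.cong refl dPe)
    then show ?thesis
      by (simp add: sum_subtractf sum.distrib diag RT del: One_nat_def flip: sum_distrib_left)
  qed
  have sum_deP: "(\<Sum>i=1..M. d Pens (P i)) = (\<Sum>i=1..M. d (P i) Pens)"
    by (intro sum.cong refl) (simp add: deP dPe)
  have sum_dPs: "(\<Sum>i=1..M. d (P i) Ps) = real M * V - 2 * (real M * U) + 1 / (2 * sqrt pi) * A"
  proof -
    have "(\<Sum>i=1..M. d (P i) Ps) = (\<Sum>i=1..M. V - 2 * K i + G i i)"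
      by (intro sum.cong refl dPs)
    then show ?thesis
      by (simp add: sum_subtractf sum.distrib diag KU del: One_nat_def flip: sum_distrib_left)
  qed
  have sum_dsP: "(\<Sum>i=1..M. d Ps (P i)) = (\<Sum>i=1..M. d (P i) Ps)"
    by (intro sum.cong refl) (simp add: dsP dPs)

  \<comment> \<open>After rewriting, every claim is an identity in \<open>A\<close>,
    \<open>T\<close>, \<open>U\<close>, \<open>V\<close> and \<open>real M\<close>; since M is
    nonzero, the denominators can be cleared.\<close>
  show ?thesis
    unfolding G_def[symmetric] K_def[symmetric] A_def[symmetric] V_def[symmetric]
      sum_HP sum_S sum_dPP sum_deP sum_dPe sum_dsP sum_dPs GT KU Hs He dse des
    using M by (simp add: power2_eq_square field_simps)
qed

end
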